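(* Let $H$ be an infinite-dimensional separable complex Hilbert space. Then $|U(H)|=|G|=|G_s|=\mathfrak{c}$.
   Context: $\mathfrak{c}$ denotes the cardinality of the continuum and $|X|$ the cardinality of a set $X$. $U(H)$ is the group of unitary operators on $H$. $G$ is the group of all bijective linear operators on $H\oplus\mathbb{C}$ leaving invariant the sesquilinear form $\mathcal{A}((x,\lambda),(y,\mu))=\langle x,y\rangle-\lambda\overline{\mu}$ (such operators are automatically bounded), and $G_s$ is the set of elements of $G$ that are self-adjoint on the Hilbert space $H\oplus\mathbb{C}$ with its usual inner product. *)

theory Defs
  imports "HOL-Analysis.Analysis" "HOL-Library.Equipollence"
begin

section \<open>Complex Hilbert spaces\<close>

class scaleC =
  fixes scaleC :: "complex \<Rightarrow> 'a \<Rightarrow> 'a" (infixr \<open>*\<^sub>C\<close> 75)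

class complex_vector = real_vector + scaleC +
  assumes scaleC_add_right: "a *\<^sub>C (x + y) = a *\<^sub>C x + a *\<^sub>C y"
    and scaleC_add_left: "(a + b) *\<^sub>C x = a *\<^sub>C x + b *\<^sub>C x"
    and scaleC_scaleC: "a *\<^sub>C b *\<^sub>C x = (a * b) *\<^sub>C x"
    and scaleC_one: "1 *\<^sub>C x = x"
    and scaleR_scaleC: "scaleR r x = of_real r *\<^sub>C x"

text \<open>
  The complex inner product is linear in the first argument. The underlying real Hilbert space
  structure is that of \<^class>\<open>real_inner\<close> with inner product \<open>Re \<langle>x, y\<rangle>\<close>; definiteness of the
  complex inner product and its relation to the norm come from there
  (see \<open>cinner_self\<close> and \<open>norm_eq_sqrt_cinner\<close> below).
\<close>

class complex_inner = complex_vector + real_inner +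
  fixes cinner :: "'a \<Rightarrow> 'a \<Rightarrow> complex"
  assumes cinner_commute: "cinner x y = cnj (cinner y x)"
    and cinner_add_left: "cinner (x + y) z = cinner x z + cinner y z"
    and cinner_scaleC_left: "cinner (a *\<^sub>C x) y = a * cinner x y"
    and inner_eq_Re_cinner: "inner x y = Re (cinner x y)"

class complex_hilbert_space = complex_inner + complete_space

lemma cinner_self: "cinner x x = complex_of_real ((norm x)\<^sup>2)"
proof (rule complex_eqI)
  show "Re (cinner x x) = Re (complex_of_real ((norm x)\<^sup>2))"
    by (simp add: inner_eq_Re_cinner[symmetric] power2_norm_eq_inner)
  have "Im (cinner x x) = - Im (cinner x x)"
    by (subst cinner_commute) simp
  then show "Im (cinner x x) = Im (complex_of_real ((norm x)\<^sup>2))"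
    by simp
qed

lemma norm_eq_sqrt_cinner: "norm x = sqrt (Re (cinner x x))"
  by (simp add: cinner_self)

lemma cinner_eq_zero_iff: "cinner x x = 0 \<longleftrightarrow> x = 0"
  by (simp add: cinner_self)

global_interpretation complex_vector: vector_space "scaleC :: complex \<Rightarrow> 'a \<Rightarrow> 'a::complex_vector"
  by unfold_locales (simp_all add: scaleC_add_right scaleC_add_left scaleC_scaleC scaleC_one)

abbreviation clinear :: "('a::complex_vector \<Rightarrow> 'b::complex_vector) \<Rightarrow> bool"
  where "clinear \<equiv> Vector_Spaces.linear scaleC scaleC"

definition infinite_dimensional :: "'a::complex_vector itself \<Rightarrow> bool"
  where "infinite_dimensional _ \<longleftrightarrow>
    \<not> (\<exists>B :: 'a set. finite B \<and> complex_vector.span B = UNIV)"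

section \<open>The orthogonal direct sum with the complex numbers\<close>

instantiation complex :: complex_hilbert_space
begin

definition scaleC_complex :: "complex \<Rightarrow> complex \<Rightarrow> complex"
  where "scaleC_complex a z = a * z"

definition cinner_complex :: "complex \<Rightarrow> complex \<Rightarrow> complex"
  where "cinner_complex z w = z * cnj w"

instance
  by intro_classes
    (simp_all add: scaleC_complex_def cinner_complex_def algebra_simps scaleR_conv_of_real
      inner_complex_def)

end

text \<open>
  The norm of \<^class>\<open>real_normed_vector\<close> on products is the Euclidean combination of the norms,
  so the product type is the Hilbert space direct sum.
\<close>

instantiation prod :: (complex_vector, complex_vector) complex_vector
begin

definition scaleC_prod :: "complex \<Rightarrow> 'a \<times> 'b \<Rightarrow> 'a \<times> 'b"
  where "scaleC_prod a u = (a *\<^sub>C fst u, a *\<^sub>C snd u)"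

instance
  by intro_classes
    (simp_all add: scaleC_prod_def prod_eq_iff scaleC_add_right scaleC_add_left scaleC_scaleC
      scaleC_one scaleR_scaleC)

end

instantiation prod :: (complex_inner, complex_inner) complex_inner
begin

definition cinner_prod :: "'a \<times> 'b \<Rightarrow> 'a \<times> 'b \<Rightarrow> complex"
  where "cinner_prod u v = cinner (fst u) (fst v) + cinner (snd u) (snd v)"

instance
proof
  fix u v w :: "'a \<times> 'b" and a :: complex
  show "cinner u v = cnj (cinner v u)"
    by (simp add: cinner_prod_def cinner_commute[symmetric])
  show "cinner (u + v) w = cinner u w + cinner v w"
    by (simp add: cinner_prod_def cinner_add_left)
  show "cinner (a *\<^sub>C u) v = a * cinner u v"
    by (simp add: cinner_prod_def scaleC_prod_def cinner_scaleC_left distrib_left)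
  show "inner u v = Re (cinner u v)"
    by (simp add: cinner_prod_def inner_prod_def inner_eq_Re_cinner)
qed

end

instance prod :: (complex_hilbert_space, complex_hilbert_space) complex_hilbert_space ..

section \<open>Unitary and self-adjoint operators\<close>

definition is_adjoint :: "('a::complex_inner \<Rightarrow> 'b::complex_inner) \<Rightarrow> ('b \<Rightarrow> 'a) \<Rightarrow> bool"
  where "is_adjoint T S \<longleftrightarrow> (\<forall>x y. cinner (T x) y = cinner x (S y))"

lemma is_adjoint_unique:
  assumes "is_adjoint T S" "is_adjoint T S'"
  shows "S = S'"
proof
  fix y
  have "inner x (S y) = inner x (S' y)" for x
    using assms by (simp add: is_adjoint_def inner_eq_Re_cinner)
  then show "S y = S' y"
    by (metis vector_eq_ldot)
qed

definition self_adjoint :: "('a::complex_inner \<Rightarrow> 'a) \<Rightarrow> bool"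
  where "self_adjoint T \<longleftrightarrow> is_adjoint T T"

definition unitary :: "('a::complex_inner \<Rightarrow> 'a) \<Rightarrow> bool"
  where "unitary T \<longleftrightarrow> clinear T \<and> bounded_linear T \<and>
    (\<exists>S. is_adjoint T S \<and> S \<circ> T = id \<and> T \<circ> S = id)"

definition unitary_group :: "('a::complex_hilbert_space \<Rightarrow> 'a) set"
  where "unitary_group = {T. unitary T}"

section \<open>The isometry group of the indefinite form\<close>

definition form_A :: "'a::complex_hilbert_space \<times> complex \<Rightarrow> 'a \<times> complex \<Rightarrow> complex"
  where "form_A = (\<lambda>(x, l) (y, m). cinner x y - l * cnj m)"

definition group_G :: "('a::complex_hilbert_space \<times> complex \<Rightarrow> 'a \<times> complex) set"
  where "group_G = {T. clinear T \<and> bij T \<and> (\<forall>u v. form_A (T u) (T v) = form_A u v)}"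

definition G_sa :: "('a::complex_hilbert_space \<times> complex \<Rightarrow> 'a \<times> complex) set"
  where "G_sa = {T \<in> group_G. self_adjoint T}"

end

theory Submission
  imports Defs
begin

text \<open>
  An element of \<open>G\<close> is determined by its values on a dense set, even without using its
  boundedness: it is onto, it preserves the form \<open>\<A>\<close>, and \<open>\<A>\<close> is continuous and nondegenerate.
  Since the space is separable, values can in turn be recorded by countably many conditions of the
  kind \<open>dist (T d) e < 1 / (n + 1)\<close>, so \<open>G\<close> injects into the subsets of a countable set. The group
  \<open>U(H)\<close> embeds into \<open>G\<close> by letting a unitary act trivially on \<open>\<complex>\<close>. Conversely \<open>U(H)\<close> contains the
  scalars of modulus one, and \<open>G\<^sub>s\<close> contains the hyperbolic rotations (Lorentz boosts) in the plane
  spanned by a unit vector of \<open>H\<close> and \<open>(0, 1)\<close>.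
\<close>

section \<open>Families of functions determined on a countable set\<close>

lemma lepoll_reals_of_determined:
  fixes F :: "('a \<Rightarrow> 'b::metric_space) set" and E :: "'b set"
  assumes "countable D" "countable E" and dense: "closure E = UNIV"
    and determined: "\<And>f g. f \<in> F \<Longrightarrow> g \<in> F \<Longrightarrow> (\<And>d. d \<in> D \<Longrightarrow> f d = g d) \<Longrightarrow> f = g"
  shows "F \<lesssim> (UNIV :: real set)"
proof -
  define I where "I = D \<times> E \<times> (UNIV :: nat set)"
  define code where
    "code f = {(d, e, n). d \<in> D \<and> e \<in> E \<and> dist (f d) e < inverse (real (Suc n))}" for f :: "'a \<Rightarrow> 'b"
  have "countable I"
    unfolding I_def using assms by auto
  have "inj_on code F"
  proof (rule inj_onI)
    fix f g assume F: "f \<in> F" "g \<in> F" and eq: "code f = code g"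
    have "f d = g d" if "d \<in> D" for d
    proof (rule ccontr)
      assume "f d \<noteq> g d"
      then have "dist (f d) (g d) / 2 > 0" by simp
      \<comment> \<open>The balls of radius \<open>inverse (Suc n)\<close> around \<open>f d\<close>
        and \<open>g d\<close> are now disjoint, so a point of \<open>E\<close> close to
        \<open>f d\<close> separates the two codes.\<close>
      then obtain n where n: "inverse (real (Suc n)) < dist (f d) (g d) / 2"
        using reals_Archimedean by blast
      have "f d \<in> closure E" by (simp add: dense)
      then obtain e where "e \<in> E" "dist e (f d) < inverse (real (Suc n))"
        unfolding closure_approachable
        by (meson inverse_positive_iff_positive of_nat_0_less_iff zero_less_Suc)
      then have e: "e \<in> E" "dist (f d) e < inverse (real (Suc n))"
        by (simp_all add: dist_commute)
      then have "(d, e, n) \<in> code g"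
        unfolding eq[symmetric] using that by (simp add: code_def)
      then have "dist (g d) e < inverse (real (Suc n))"
        by (simp add: code_def)
      with e n dist_triangle2[of "f d" "g d" e] show False by linarith
    qed
    with F show "f = g" by (rule determined)
  qed
  moreover have "code ` F \<subseteq> Pow I"
    by (auto simp: code_def I_def)
  ultimately have "F \<lesssim> Pow I"
    unfolding lepoll_def by blast
  also have "Pow I \<lesssim> (UNIV :: nat set set)"
    unfolding lepoll_def
    using inj_on_image_Pow[OF inj_on_to_nat_on[OF \<open>countable I\<close>]] by blast
  also have "(UNIV :: nat set set) \<approx> (UNIV :: real set)"
    by (rule nat_sets_eqpoll_reals)
  finally show ?thesis .
qed

section \<open>Complex inner products\<close>

lemma cinner_add_right: "cinner x (y + z) = cinner x y + cinner x z"
  by (subst (1 2 3) cinner_commute) (simp add: cinner_add_left)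

lemma cinner_scaleC_right: "cinner x (a *\<^sub>C y) = cnj a * cinner x y"
  by (subst (1 2) cinner_commute) (simp add: cinner_scaleC_left)

lemma clinear_iff:
  "clinear T \<longleftrightarrow> (\<forall>x y. T (x + y) = T x + T y) \<and> (\<forall>a x. T (a *\<^sub>C x) = a *\<^sub>C T x)"
  by (simp add: Vector_Spaces.linear_iff complex_vector.vector_space_axioms)

text \<open>The class axioms tie the norm to real scaling only; \<open>cinner_self\<close> carries
  homogeneity over to complex scalars.\<close>

lemma norm_scaleC: "norm (a *\<^sub>C x) = cmod a * norm (x :: 'a::complex_inner)"
proof -
  have "complex_of_real ((norm (a *\<^sub>C x))\<^sup>2) = (a * cnj a) * cinner x x"
    unfolding cinner_self[symmetric]
    by (simp add: cinner_scaleC_left cinner_scaleC_right)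
  also have "\<dots> = complex_of_real ((cmod a * norm x)\<^sup>2)"
    by (simp add: cinner_self power_mult_distrib flip: complex_norm_square)
  finally have "(norm (a *\<^sub>C x))\<^sup>2 = (cmod a * norm x)\<^sup>2"
    by (simp only: of_real_eq_iff)
  then show ?thesis
    by (simp add: power2_eq_iff_nonneg)
qed

lemma bounded_linear_scaleC: "bounded_linear (\<lambda>x :: 'a::complex_inner. a *\<^sub>C x)"
  by (rule bounded_linear_intro[where K = "cmod a"])
    (simp_all add: scaleC_add_right scaleR_scaleC scaleC_scaleC norm_scaleC mult.commute)

lemma unit_vector_exists:
  assumes "infinite_dimensional TYPE('h::complex_hilbert_space)"
  obtains e :: "'h::complex_hilbert_space" where "norm e = 1"
proof -
  \<comment> \<open>The empty set is finite and spans only 0.\<close>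
  have "complex_vector.span {} \<noteq> (UNIV :: 'h set)"
    using assms unfolding infinite_dimensional_def by blast
  then obtain x :: 'h where "x \<noteq> 0"
    by auto
  then have "norm (sgn x) = 1"
    by (simp add: norm_sgn)
  with that show ?thesis .
qed

section \<open>The upper bound\<close>

text \<open>The reflection in the last coordinate turns the form into the inner product, so
  continuity and nondegeneracy are inherited from the Hilbert space.\<close>

lemma form_A_eq_cinner: "form_A u v = cinner u (fst v, - snd v)"
  by (simp add: form_A_def cinner_prod_def cinner_complex_def split_beta)

text \<open>The vectors orthogonal to the reflected difference of \<open>v\<close> and
  \<open>w\<close> form a closed set containing \<open>D\<close>, hence include that difference
  itself.\<close>

lemma form_A_cancel_dense:
  assumes "closure D = UNIV" and eq: "\<And>d. d \<in> D \<Longrightarrow> form_A d v = form_A d w"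
  shows "v = w"
proof -
  define v' where "v' = (fst v, - snd v)"
  define w' where "w' = (fst w, - snd w)"
  have "inner d v' = inner d w'" if "d \<in> D" for d
    using eq[OF that] by (simp add: inner_eq_Re_cinner form_A_eq_cinner v'_def w'_def)
  then have "inner d (v' - w') = 0" if "d \<in> D" for d
    using that by (simp add: inner_diff_right)
  then have "closure D \<subseteq> {d. inner d (v' - w') = 0}"
    by (intro closure_minimal closed_Collect_eq continuous_intros) auto
  then have "inner (v' - w') (v' - w') = 0"
    using assms(1) by blast
  then have "v' = w'"
    by simp
  then show ?thesis
    by (simp add: v'_def w'_def prod_eq_iff)
qed

lemma group_G_eqI_dense:
  assumes "closure D = UNIV" and S: "S \<in> group_G" and T: "T \<in> group_G"
    and eq: "\<And>d. d \<in> D \<Longrightarrow> S d = T d"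
  shows "S = T"
proof
  fix v
  from S have "surj S"
    by (simp add: group_G_def bij_is_surj)
  \<comment> \<open>Pairing this with \<open>T d = S d\<close> and cancelling both isometries
    compares \<open>v\<close> with \<open>w\<close> on \<open>D\<close>.\<close>
  then obtain w where w: "T v = S w"
    by (metis surjD)
  have "form_A d v = form_A d w" if "d \<in> D" for d
  proof -
    have "form_A d v = form_A (T d) (T v)"
      using T by (simp add: group_G_def del: split_paired_All)
    also have "\<dots> = form_A (S d) (S w)"
      using eq that w by simp
    also have "\<dots> = form_A d w"
      using S by (simp add: group_G_def del: split_paired_All)
    finally show ?thesis .
  qed
  then have "v = w"
    by (rule form_A_cancel_dense[OF assms(1)])
  with w show "S v = T v" by simp
qed

lemma group_G_lepoll_reals:
  assumes "separable_space (euclidean :: 'h::complex_hilbert_space topology)"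
  shows "(group_G :: ('h \<times> complex \<Rightarrow> 'h \<times> complex) set) \<lesssim> (UNIV :: real set)"
proof -
  obtain D :: "'h set" where D: "countable D" "closure D = UNIV"
    using assms by (auto simp: separable_space_def)
  obtain E :: "complex set" where E: "countable E" "closure E = UNIV"
    using separable[of "UNIV :: complex set"] by (metis top.extremum_uniqueI)
  \<comment> \<open>This product serves both as the set of test arguments and as the dense set of
    approximate values.\<close>
  have "countable (D \<times> E)" "closure (D \<times> E) = UNIV"
    using D E by (simp_all add: closure_Times)
  then show ?thesis
    by (intro lepoll_reals_of_determined) (auto intro: group_G_eqI_dense)
qed

lemma unitary_extend_in_group_G:
  assumes "U \<in> unitary_group"
  shows "map_prod U id \<in> group_G"
proof -
  obtain S where lin: "clinear U" and adj: "is_adjoint U S" and inv: "S \<circ> U = id" "U \<circ> S = id"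
    using assms by (auto simp: unitary_group_def unitary_def)
  have "bij U"
    using inv by (rule o_bij)
  then have "bij (map_prod U (id :: complex \<Rightarrow> complex))"
    unfolding bij_def by (simp add: map_prod_surj prod.inj_map)
  moreover have "clinear (map_prod U (id :: complex \<Rightarrow> complex))"
    using lin by (auto simp: clinear_iff scaleC_prod_def)
  moreover have "cinner (U x) (U y) = cinner x y" for x y
    using adj pointfree_idE[OF inv(1)] by (simp add: is_adjoint_def)
  ultimately show ?thesis
    by (auto simp: group_G_def form_A_def)
qed

lemma unitary_group_lepoll_group_G:
  "(unitary_group :: ('h \<Rightarrow> 'h) set) \<lesssim>
    (group_G :: ('h::complex_hilbert_space \<times> complex \<Rightarrow> 'h \<times> complex) set)"
  unfolding lepoll_def
proof (intro exI conjI image_subsetI)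
  show "inj_on (\<lambda>U. map_prod U id) unitary_group"
    by (rule inj_onI) (metis fst_map_prod fst_conv ext)
qed (rule unitary_extend_in_group_G)

section \<open>The lower bounds\<close>

lemma scaleC_in_unitary_group:
  assumes "cmod a = 1"
  shows "(scaleC a :: 'h::complex_hilbert_space \<Rightarrow> 'h) \<in> unitary_group"
proof -
  have "a * cnj a = 1" "cnj a * a = 1"
    using assms by (simp_all add: mult.commute flip: complex_norm_square)
  then have "is_adjoint (scaleC a :: 'h \<Rightarrow> 'h) (scaleC (cnj a))"
    "scaleC (cnj a) \<circ> scaleC a = (id :: 'h \<Rightarrow> 'h)"
    "scaleC a \<circ> scaleC (cnj a) = (id :: 'h \<Rightarrow> 'h)"
    by (auto simp: fun_eq_iff is_adjoint_def cinner_scaleC_left cinner_scaleC_right)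
  moreover have "clinear (scaleC a :: 'h \<Rightarrow> 'h)"
    by (simp add: clinear_iff scaleC_add_right mult.commute)
  ultimately show ?thesis
    unfolding unitary_group_def unitary_def using bounded_linear_scaleC by blast
qed

lemma reals_lepoll_unitary_group:
  fixes e :: "'h::complex_hilbert_space"
  assumes "norm e = 1"
  shows "(UNIV :: real set) \<lesssim> (unitary_group :: ('h \<Rightarrow> 'h) set)"
proof -
  have "(UNIV :: real set) \<approx> {0<..<1::real}"
    by (simp add: open_interval_eqpoll_reals eqpoll_sym)
  also have "{0<..<1::real} \<lesssim> (unitary_group :: ('h \<Rightarrow> 'h) set)"
    unfolding lepoll_def
  proof (intro exI conjI image_subsetI)
    show "inj_on (\<lambda>t. scaleC (cis t) :: 'h \<Rightarrow> 'h) {0<..<1}"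
    proof (rule inj_onI)
      fix s t :: real
      assume st: "s \<in> {0<..<1}" "t \<in> {0<..<1}" and "(scaleC (cis s) :: 'h \<Rightarrow> 'h) = scaleC (cis t)"
      \<comment> \<open>Pairing with the unit vector \<open>e\<close> recovers the scalar.\<close>
      then have "cinner (cis s *\<^sub>C e) e = cinner (cis t *\<^sub>C e) e"
        by simp
      then have "cis s = cis t"
        using assms by (simp add: cinner_scaleC_left cinner_self)
      then have "cos s = cos t"
        by (simp add: complex_eq_iff)
      \<comment> \<open>The interval (0, 1) lies inside [0, pi], where the cosine is
        injective.\<close>
      with st pi_gt3 show "s = t"
        by (simp add: cos_inj_pi)
    qed
  qed (simp add: scaleC_in_unitary_group)
  finally show ?thesis .
qed

text \<open>The parameter is \<open>s = sinh t\<close>, so that \<open>sqrt (1 + s\<^sup>2) = cosh t\<close>.\<close>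

definition boost :: "'h::complex_hilbert_space \<Rightarrow> real \<Rightarrow> 'h \<times> complex \<Rightarrow> 'h \<times> complex"
  where "boost e s u =
    (let c = complex_of_real (sqrt (1 + s\<^sup>2)); a = cinner (fst u) e
     in (fst u + ((c - 1) * a + s * snd u) *\<^sub>C e, s * a + c * snd u))"

text \<open>This is cosh^2 = 1 + sinh^2, stated with products as the polynomial relation that
  \<open>algebra\<close> uses below.\<close>

lemma of_real_cosh_square:
  "complex_of_real (sqrt (1 + s\<^sup>2)) * complex_of_real (sqrt (1 + s\<^sup>2)) = 1 + of_real s * of_real s"
  by (simp add: power2_eq_square flip: of_real_mult)

lemma clinear_boost: "clinear (boost e s)"
proof -
  define c where "c = complex_of_real (sqrt (1 + s\<^sup>2))"
  define p where "p u = (c - 1) * cinner (fst u) e + s * snd u" for u :: "_ \<times> complex"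
  have boost: "boost e s u = (fst u + p u *\<^sub>C e, s * cinner (fst u) e + c * snd u)" for u
    by (simp add: boost_def p_def Let_def flip: c_def)
  have "p (u + v) = p u + p v" for u v
    by (simp add: p_def cinner_add_left ring_distribs)
  moreover have "p (z *\<^sub>C u) = z * p u" for z u
    by (simp add: p_def scaleC_prod_def scaleC_complex_def cinner_scaleC_left ring_distribs mult_ac)
  ultimately show ?thesis
    by (simp add: clinear_iff boost scaleC_prod_def scaleC_complex_def cinner_add_left
        cinner_scaleC_left scaleC_add_right scaleC_add_left distrib_left mult_ac)
qed

text \<open>Changing the sign of \<open>s\<close> reverses the hyperbolic angle and keeps its
  cosh.\<close>

lemma boost_boost_uminus:
  assumes "norm e = 1"
  shows "boost e (- s) (boost e s u) = u"
proof -
  define c where "c = complex_of_real (sqrt (1 + s\<^sup>2))"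
  define a where "a = cinner (fst u) e"
  have c: "c * c = 1 + of_real s * of_real s"
    unfolding c_def by (rule of_real_cosh_square)
  define p where "p = (c - 1) * a + s * snd u"
  \<comment> \<open>After the first boost the coefficient along \<open>e\<close> is
    \<open>a + p\<close>; \<open>q\<close> is the multiple of \<open>e\<close> that the second boost
    adds.\<close>
  define q where "q = (c - 1) * (a + p) + - complex_of_real s * (s * a + c * snd u)"
  have ee: "cinner e e = 1"
    using assms by (simp add: cinner_self)
  have 1: "boost e (- s) (boost e s u) =
      (fst u + p *\<^sub>C e + q *\<^sub>C e,
        - complex_of_real s * (a + p) + c * (s * a + c * snd u))"
    by (simp add: boost_def Let_def cinner_add_left cinner_scaleC_left ee p_def q_def
        flip: c_def a_def)
  have "p + q = 0"
    unfolding p_def q_def using c by algebra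
  moreover have "- complex_of_real s * (a + p) + c * (s * a + c * snd u) = snd u"
    unfolding p_def using c by algebra
  ultimately show ?thesis
    unfolding 1 by (simp add: prod_eq_iff add.assoc flip: scaleC_add_left)
qed

lemma form_A_boost:
  assumes "norm e = 1"
  shows "form_A (boost e s u) (boost e s v) = form_A u v"
proof -
  define c where "c = complex_of_real (sqrt (1 + s\<^sup>2))"
  have c: "c * c = 1 + of_real s * of_real s" and cnj_c: "cnj c = c"
    unfolding c_def by (rule of_real_cosh_square, simp)
  define a where "a = cinner (fst u) e"
  define b where "b = cinner e (fst v)"
  define p where "p = (c - 1) * a + s * snd u"
  \<comment> \<open>The multiple of \<open>e\<close> added to \<open>fst v\<close> is
    \<open>cnj q\<close>. Conjugating here, as in \<open>b\<close>, leaves a polynomial identity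
    modulo the relation \<open>c\<close>.\<close>
  define q where "q = (c - 1) * b + s * cnj (snd v)"
  have b: "cinner (fst v) e = cnj b"
    unfolding b_def by (rule cinner_commute)
  have ee: "cinner e e = 1"
    using assms by (simp add: cinner_self)
  have "boost e s u = (fst u + p *\<^sub>C e, s * a + c * snd u)"
    by (simp add: boost_def Let_def p_def flip: c_def a_def)
  moreover have "boost e s v = (fst v + cnj q *\<^sub>C e, s * cnj b + c * snd v)"
    by (simp add: boost_def Let_def q_def b cnj_c flip: c_def)
  ultimately have "form_A (boost e s u) (boost e s v) =
      cinner (fst u) (fst v) + q * a + p * b + p * q
        - (s * a + c * snd u) * (s * b + c * cnj (snd v))"
    by (simp add: form_A_def cinner_add_left cinner_add_right cinner_scaleC_left
        cinner_scaleC_right ee cnj_c distrib_left flip: a_def b_def)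
  also have "\<dots> = cinner (fst u) (fst v) - snd u * cnj (snd v)"
    unfolding p_def q_def using c by algebra
  finally show ?thesis
    by (simp add: form_A_def split_beta)
qed

text \<open>For a unit vector \<open>e\<close>, the boost has the real symmetric matrix with rows
  (cosh, sinh) and (sinh, cosh) on the plane of \<open>e\<close> and (0, 1), and is the identity on
  the orthogonal complement.\<close>

lemma self_adjoint_boost: "self_adjoint (boost e s)"
proof -
  have "cinner (boost e s u) v = cinner u (boost e s v)" for u v
    by (simp add: boost_def Let_def cinner_prod_def cinner_complex_def cinner_add_left
        cinner_add_right cinner_scaleC_left cinner_scaleC_right
        ring_distribs mult_ac cinner_commute[of "fst v" e])
  then show ?thesis
    by (simp add: self_adjoint_def is_adjoint_def)
qed

lemma boost_in_G_sa:
  assumes "norm e = 1"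
  shows "boost e s \<in> G_sa"
proof -
  have "boost e (- s) \<circ> boost e s = id" "boost e s \<circ> boost e (- s) = id"
    using boost_boost_uminus[OF assms, of s] boost_boost_uminus[OF assms, of "- s"] by auto
  then have "bij (boost e s)"
    by (rule o_bij)
  then show ?thesis
    by (simp add: G_sa_def group_G_def clinear_boost form_A_boost[OF assms] self_adjoint_boost)
qed

lemma reals_lepoll_G_sa:
  fixes e :: "'h::complex_hilbert_space"
  assumes "norm e = 1"
  shows "(UNIV :: real set) \<lesssim> (G_sa :: ('h \<times> complex \<Rightarrow> 'h \<times> complex) set)"
  unfolding lepoll_def
proof (intro exI conjI image_subsetI)
  show "inj (boost e)"
  proof (rule injI)
    fix s t assume "boost e s = boost e t"
    \<comment> \<open>The last coordinate of the image of \<open>(e, 0)\<close> is the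
      parameter.\<close>
    then have "snd (boost e s (e, 0)) = snd (boost e t (e, 0))"
      by simp
    then show "s = t"
      using assms by (simp add: boost_def Let_def cinner_self)
  qed
qed (rule boost_in_G_sa[OF assms])

theorem proposition4p2:
  assumes "infinite_dimensional TYPE('h::complex_hilbert_space)"
    and "separable_space (euclidean :: 'h topology)"
  shows "(unitary_group :: ('h \<Rightarrow> 'h) set) \<approx> (UNIV :: real set)
    \<and> (group_G :: ('h \<times> complex \<Rightarrow> 'h \<times> complex) set) \<approx> (UNIV :: real set)
    \<and> (G_sa :: ('h \<times> complex \<Rightarrow> 'h \<times> complex) set) \<approx> (UNIV :: real set)"
proof -
  obtain e :: 'h where e: "norm e = 1"
    using assms(1) by (rule unit_vector_exists)
  let ?U = "unitary_group :: ('h \<Rightarrow> 'h) set"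
  let ?G = "group_G :: ('h \<times> complex \<Rightarrow> 'h \<times> complex) set"
  let ?S = "G_sa :: ('h \<times> complex \<Rightarrow> 'h \<times> complex) set"
  have G: "?G \<lesssim> (UNIV :: real set)"
    using assms(2) by (rule group_G_lepoll_reals)
  have U: "?U \<lesssim> (UNIV :: real set)"
    using unitary_group_lepoll_group_G G by (rule lepoll_trans)
  have sub: "?S \<lesssim> ?G"
    by (rule subset_imp_lepoll) (auto simp: G_sa_def)
  show ?thesis
    \<comment> \<open>The lower bound for \<open>?G\<close> comes from \<open>?S\<close>;
      Schroeder-Bernstein closes all three cases.\<close>
    using U G sub reals_lepoll_unitary_group[OF e] reals_lepoll_G_sa[OF e]
    by (meson lepoll_antisym lepoll_trans)
qed

end
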